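(* Let $\mathcal{S}=(\Gamma,(S_i)_{i\in V},(f_i)_{i\in V})$ be an update system defined on a directed acyclic graph $\Gamma=(V,E)$. Then the $\Gamma$-local functions $\mathbf{F}_i$ satisfy: (i) $\mathbf{F}_i^2=\mathbf{F}_i$ for every $i\in V$; (ii) $\mathbf{F}_i\mathbf{F}_j\mathbf{F}_i=\mathbf{F}_j\mathbf{F}_i\mathbf{F}_j=\mathbf{F}_i\mathbf{F}_j$ if $i\to j$ (and hence there is no arrow $j\to i$); (iii) $\mathbf{F}_i\mathbf{F}_j=\mathbf{F}_j\mathbf{F}_i$ if $i$ and $j$ are not connected (i.e. there is neither an arrow $i\to j$ nor an arrow $j\to i$).
   Context: An update system is a triple $\mathcal{S}=(\Gamma,(S_i)_{i\in V},(f_i)_{i\in V})$ where: $\Gamma=(V,E)$ is a finite directed graph with $E\subseteq V\times V$ (write $i\to j$ for $(i,j)\in E$); each $S_i$ is a finite set (of states); and, with $x[i]=\{j: i\to j\}$ and $S[i]=\prod_{j\in x[i]}S_j$, each $f_i:S[i]\to S_i$ is a function (a constant if $x[i]$ is empty). Let $S=\prod_{i\in V}S_i$, and for $\mathbf{s}=(s_j)_{j\in V}\in S$ let $\mathbf{s}[i]=(s_j)_{j\in x[i]}$. The $\Gamma$-local function $\mathbf{F}_i:S\to S$ is $\mathbf{F}_i(\mathbf{s})=(t_j)_{j\in V}$ with $t_j=s_j$ for $j\neq i$ and $t_i=f_i(\mathbf{s}[i])$. Products of $\mathbf{F}_i$'s are compositions of maps. Acyclic means without oriented cycles (in particular, without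 self-loops). *)

theory Defs
  imports "HOL-Library.FuncSet"
begin

text \<open>
  The state sets are subsets of one ambient type; every finite family of sets embeds in such a
  family. Tuples over an index set are the extensional functions of \<^const>\<open>PiE\<close>, so that two
  tuples are equal iff they agree on the index set.
\<close>

definition state_space :: "'v set \<Rightarrow> ('v \<Rightarrow> 's set) \<Rightarrow> ('v \<Rightarrow> 's) set" where
  "state_space V S = (\<Pi>\<^sub>E i\<in>V. S i)"

definition out_nbrs :: "('v \<times> 'v) set \<Rightarrow> 'v \<Rightarrow> 'v set" where
  "out_nbrs E i = {j. (i, j) \<in> E}"

text \<open>
  If \<open>out_nbrs E i\<close> is empty, the domain of \<open>f i\<close> is a singleton and \<open>f i\<close> amounts to a constant.
\<close>

locale update_system =
  fixes V :: "'v set"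
    and E :: "('v \<times> 'v) set"
    and S :: "'v \<Rightarrow> 's set"
    and f :: "'v \<Rightarrow> ('v \<Rightarrow> 's) \<Rightarrow> 's"
  assumes finite_vertices: "finite V"
    and edges: "E \<subseteq> V \<times> V"
    and finite_states: "i \<in> V \<Longrightarrow> finite (S i)"
    and update: "i \<in> V \<Longrightarrow> f i \<in> state_space (out_nbrs E i) S \<rightarrow> S i"

text \<open>
  Local functions are extensional on the state space, so equality of maps on the state space
  is equality in HOL; accordingly their products are formed with \<^const>\<open>compose\<close>, where
  \<open>compose A g h\<close> applies \<open>h\<close> first.
\<close>

definition local_fun ::
  "'v set \<Rightarrow> ('v \<times> 'v) set \<Rightarrow> ('v \<Rightarrow> 's set) \<Rightarrow> ('v \<Rightarrow> ('v \<Rightarrow> 's) \<Rightarrow> 's)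
    \<Rightarrow> 'v \<Rightarrow> ('v \<Rightarrow> 's) \<Rightarrow> ('v \<Rightarrow> 's)" where
  "local_fun V E S f i = (\<lambda>s\<in>state_space V S. s(i := f i (restrict s (out_nbrs E i))))"

lemma (in update_system) local_fun_in:
  assumes "i \<in> V"
  shows "local_fun V E S f i \<in> state_space V S \<rightarrow>\<^sub>E state_space V S"
proof -
  have "s(i := f i (restrict s (out_nbrs E i))) \<in> state_space V S" if s: "s \<in> state_space V S" for s
  proof -
    have "restrict s (out_nbrs E i) \<in> state_space (out_nbrs E i) S"
      using s edges by (auto simp: state_space_def out_nbrs_def)
    then have "f i (restrict s (out_nbrs E i)) \<in> S i"
      using update[OF assms] by auto
    then show ?thesis
      using s assms by (auto simp: state_space_def PiE_iff extensional_def)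
  qed
  then show ?thesis
    by (auto simp: local_fun_def)
qed

end

theory Submission
  imports Defs
begin

text \<open>
  \<open>F\<^sub>i\<close> changes only the coordinate \<open>i\<close>, and the value it writes does not depend on coordinates
  outside the out-neighbourhood of \<open>i\<close>. Hence if there is no arrow \<open>j \<rightarrow> i\<close>, then an application of
  \<open>F\<^sub>i\<close> does not affect the value that \<open>F\<^sub>j\<close> writes. All three relations follow by comparing the
  last values written to each coordinate.
\<close>

lemma restrict_fun_upd_notin: "i \<notin> A \<Longrightarrow> restrict (s(i := v)) A = restrict s A"
  by (auto simp: restrict_def)

lemma local_fun_apply:
  "s \<in> state_space V S \<Longrightarrow> local_fun V E S f i s = s(i := f i (restrict s (out_nbrs E i)))"
  by (simp add: local_fun_def)

text \<open>Used to view \<open>F\<^sub>i s\<close> as a single update of \<open>s\<close> with an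
  opaque value, so that the two lemmas below, stated for an arbitrary \<open>v\<close>, apply
  without unfolding \<open>f\<close>.\<close>

lemma local_fun_eq_fun_upd:
  "s \<in> state_space V S \<Longrightarrow> local_fun V E S f i s = s(i := local_fun V E S f i s i)"
  by (simp add: local_fun_apply)

text \<open>Without an arrow from \<open>j\<close> to \<open>i\<close>, \<open>f j\<close> does not
  read coordinate \<open>i\<close>. Both tuples must lie in the state space, since
  \<open>local_fun\<close> is given by its formula only there.\<close>

lemma local_fun_fun_upd_other:
  assumes "s \<in> state_space V S" and "s(i := v) \<in> state_space V S" and "(j, i) \<notin> E" and "i \<noteq> j"
  shows "local_fun V E S f j (s(i := v)) = (local_fun V E S f j s)(i := v)"
  using assms by (simp add: local_fun_apply restrict_fun_upd_notin out_nbrs_def fun_upd_twist)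

lemma local_fun_fun_upd_same:
  assumes "s \<in> state_space V S" and "s(i := v) \<in> state_space V S" and "(i, i) \<notin> E"
  shows "local_fun V E S f i (s(i := v)) = local_fun V E S f i s"
  using assms by (simp add: local_fun_apply restrict_fun_upd_notin out_nbrs_def)

context update_system
begin

lemma local_fun_closed:
  assumes "i \<in> V" and "s \<in> state_space V S"
  shows "local_fun V E S f i s \<in> state_space V S"
  using local_fun_in[OF assms(1)] assms(2) by (rule PiE_mem)

lemma local_fun_idem:
  assumes "i \<in> V" and "(i, i) \<notin> E" and "s \<in> state_space V S"
  shows "local_fun V E S f i (local_fun V E S f i s) = local_fun V E S f i s"
  by (metis assms local_fun_closed local_fun_eq_fun_upd local_fun_fun_upd_same)

text \<open>The value at \<open>i\<close> is computed from \<open>s\<close> and survives, as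
  \<open>F\<^sub>j\<close> writes elsewhere; \<open>F\<^sub>j\<close> writes what it would have
  written on \<open>s\<close>. An arrow from \<open>i\<close> to \<open>j\<close> is still allowed,
  which relation (ii) relies on.\<close>

lemma local_fun_local_fun:
  assumes "i \<in> V" and "(j, i) \<notin> E" and "i \<noteq> j" and "s \<in> state_space V S"
  shows "local_fun V E S f j (local_fun V E S f i s) =
    (local_fun V E S f j s)(i := local_fun V E S f i s i)"
  by (metis assms local_fun_closed local_fun_eq_fun_upd local_fun_fun_upd_other)

text \<open>For distinct vertices, both orders write the values computed from \<open>s\<close>
  itself, and updates of different coordinates commute.\<close>

lemma local_fun_commute:
  assumes "i \<in> V" and "j \<in> V" and "(i, j) \<notin> E" and "(j, i) \<notin> E" and "s \<in> state_space V S"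
  shows "local_fun V E S f i (local_fun V E S f j s) = local_fun V E S f j (local_fun V E S f i s)"
proof (cases "i = j")
  case False
  then have "j \<noteq> i"
    by simp
  show ?thesis
    unfolding local_fun_local_fun[OF assms(2,3) \<open>j \<noteq> i\<close> assms(5)]
      local_fun_local_fun[OF assms(1,4) False assms(5)]
    using False by (simp add: local_fun_apply[OF assms(5)] fun_upd_twist)
qed simp

text \<open>The first \<open>F\<^sub>i\<close> leaves a trace only at coordinate \<open>i\<close>
  after \<open>F\<^sub>j\<close>, and the last \<open>F\<^sub>i\<close> overwrites that coordinate
  without reading it.\<close>

lemma local_fun_absorb_right:
  assumes "i \<in> V" and "j \<in> V" and "(i, i) \<notin> E" and "(j, i) \<notin> E" and "i \<noteq> j"
    and "s \<in> state_space V S"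
  shows "local_fun V E S f i (local_fun V E S f j (local_fun V E S f i s)) =
    local_fun V E S f i (local_fun V E S f j s)"
  by (metis assms local_fun_closed local_fun_local_fun local_fun_fun_upd_same)

text \<open>Applying \<open>local_fun_local_fun\<close> at the state \<open>F\<^sub>j s\<close>
  turns the outer \<open>F\<^sub>j\<close> into a second \<open>F\<^sub>j\<close> directly after the
  first, where idempotence removes it.\<close>

lemma local_fun_absorb_left:
  assumes "i \<in> V" and "j \<in> V" and "(j, j) \<notin> E" and "(j, i) \<notin> E" and "i \<noteq> j"
    and "s \<in> state_space V S"
  shows "local_fun V E S f j (local_fun V E S f i (local_fun V E S f j s)) =
    local_fun V E S f i (local_fun V E S f j s)"
  by (metis assms local_fun_closed local_fun_local_fun local_fun_idem local_fun_eq_fun_upd)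

end

theorem proposition2p4:
  fixes V :: "'v set"
    and E :: "('v \<times> 'v) set"
    and S :: "'v \<Rightarrow> 's set"
    and f :: "'v \<Rightarrow> ('v \<Rightarrow> 's) \<Rightarrow> 's"
  defines "X \<equiv> state_space V S"
    and "F \<equiv> local_fun V E S f"
  assumes "update_system V E S f"
    and "acyclic E"
  shows "(\<forall>i\<in>V. compose X (F i) (F i) = F i) \<and>
         (\<forall>i\<in>V. \<forall>j\<in>V. (i, j) \<in> E \<longrightarrow>
           (j, i) \<notin> E \<and>
           compose X (F i) (compose X (F j) (F i)) = compose X (F j) (compose X (F i) (F j)) \<and>
           compose X (F j) (compose X (F i) (F j)) = compose X (F i) (F j)) \<and>
         (\<forall>i\<in>V. \<forall>j\<in>V. (i, j) \<notin> E \<and> (j, i) \<notin> E \<longrightarrow>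
           compose X (F i) (F j) = compose X (F j) (F i))"
proof -
  interpret update_system V E S f by fact
  have irrefl: "(i, i) \<notin> E" for i
    using \<open>acyclic E\<close> by (auto simp: acyclic_def)
  \<comment> \<open>Opposite arrows would form a cycle of length two.\<close>
  have asym: "(j, i) \<notin> E" if "(i, j) \<in> E" for i j
    using \<open>acyclic E\<close> that by (meson acyclic_def trancl.simps)
  have ext: "F i \<in> extensional X" for i
    by (simp add: F_def X_def local_fun_def)
  have "compose X (F i) (F i) = F i" if "i \<in> V" for i
    by (rule extensionalityI[OF compose_extensional ext])
      (simp add: compose_eq F_def X_def local_fun_idem that irrefl)
  \<comment> \<open>Both threefold products are reduced to the common value
    \<open>compose X (F i) (F j)\<close>; all sides are extensional on \<open>X\<close>, so
    comparing them at states suffices.\<close>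
  moreover have "compose X (F i) (compose X (F j) (F i)) = compose X (F i) (F j)"
    "compose X (F j) (compose X (F i) (F j)) = compose X (F i) (F j)"
    if "i \<in> V" "j \<in> V" "(i, j) \<in> E" for i j
  proof -
    have "i \<noteq> j"
      using irrefl that by auto
    then show "compose X (F i) (compose X (F j) (F i)) = compose X (F i) (F j)"
      "compose X (F j) (compose X (F i) (F j)) = compose X (F i) (F j)"
      using that irrefl asym
      by (auto intro!: extensionalityI[OF compose_extensional compose_extensional]
          simp: compose_eq F_def X_def local_fun_absorb_right local_fun_absorb_left)
  qed
  moreover have "compose X (F i) (F j) = compose X (F j) (F i)"
    if "i \<in> V" "j \<in> V" "(i, j) \<notin> E" "(j, i) \<notin> E" for i j
    by (rule extensionalityI[OF compose_extensional compose_extensional])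
      (simp add: compose_eq F_def X_def local_fun_commute that)
  ultimately show ?thesis
    using asym by simp
qed

end
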